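(* For every $n\ge 1$, the Birkhoff polytope $\mathrm{Birk}_n$ is indecomposable.
   Context: The Birkhoff polytope $\mathrm{Birk}_n\subset\mathbb{R}^{n\times n}$ is the convex hull of all $n\times n$ permutation matrices, equivalently the polytope of doubly stochastic $n\times n$ matrices. The Minkowski sum is $Q+R=\{q+r: q\in Q, r\in R\}$. Two polytopes are homothetic if one is obtained from the other by a translation and a dilation with positive factor. A polytope $P$ is decomposable if there are polytopes $Q,R$ with $P=Q+R$ such that neither $Q$ nor $R$ is homothetic to $P$; otherwise $P$ is indecomposable (so a single point is indecomposable). *)

theory Defs
  imports "HOL-Analysis.Analysis" "HOL-Library.Set_Algebras"
begin

definition permutation_matrices :: "(real^'n^'n) set" where
  "permutation_matrices = {\<chi> i j. if p i = j then 1 else 0 | p. p permutes UNIV}"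

definition Birkhoff :: "(real^'n^'n) set" where
  "Birkhoff = convex hull permutation_matrices"

definition homothetic :: "'a::real_vector set \<Rightarrow> 'a set \<Rightarrow> bool" where
  "homothetic P Q \<longleftrightarrow> (\<exists>c t. c > 0 \<and> Q = (\<lambda>x. c *\<^sub>R x + t) ` P)"

text \<open>On sets, \<open>+\<close> is the Minkowski sum. The library's \<open>polytope\<close> admits the empty set, but
  for nonempty \<open>P\<close> the equation \<open>P = Q + R\<close> forces both summands to be nonempty.\<close>

definition decomposable :: "'a::real_vector set \<Rightarrow> bool" where
  "decomposable P \<longleftrightarrow> polytope P \<and>
     (\<exists>Q R. polytope Q \<and> polytope R \<and> P = Q + R \<and> \<not> homothetic P Q \<and> \<not> homothetic P R)"

definition indecomposable :: "'a::real_vector set \<Rightarrow> bool" where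
  "indecomposable P \<longleftrightarrow> polytope P \<and> \<not> decomposable P"

end

theory Submission
  imports Defs
begin

text \<open>
  Suppose \<open>Birkhoff = Q + R\<close>. Let \<open>a\<close> be the matrix whose entries are the minima over \<open>Q\<close> of the
  coordinate functions. Since all points of the sum have nonnegative entries, the translates \<open>Q - a\<close>
  and \<open>R + a\<close> both consist of nonnegative matrices, and since all points of the sum have row and
  column sums \<open>1\<close>, the row and column sums are constant on \<open>Q - a\<close>.

  Write a permutation matrix \<open>V\<close> as \<open>x + y\<close> with \<open>x\<close> in \<open>Q - a\<close> and \<open>y\<close> in \<open>R + a\<close>. As \<open>x\<close> and
  \<open>y\<close> are nonnegative, they vanish wherever \<open>V\<close> does, so the only entry of \<open>x\<close> that can be nonzero in row \<open>i\<close>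
  is at column \<open>p i\<close>, where \<open>p\<close> is the permutation of \<open>V\<close>. This entry is at once the \<open>i\<close>-th
  row sum and the \<open>p i\<close>-th column sum of \<open>x\<close>. These sums do not depend on \<open>V\<close>, and some permutation
  sends any given \<open>i\<close> to any given \<open>j\<close>; hence all of them equal one number \<open>l\<close>, and
  \<open>x = l *\<^sub>R V\<close>, \<open>y = (1 - l) *\<^sub>R V\<close>, with \<open>0 \<le> l \<le> 1\<close>.

  By convexity \<open>Q - a\<close> contains \<open>l\<close> times the polytope and \<open>R + a\<close> contains \<open>1 - l\<close> times it
  (lemma \<open>Birkhoff_summands_contain_scaled_copies\<close>). Neither containment can be strict if its factor
  is positive (lemma \<open>homothetic_summand\<close>, a cancellation argument), and one of the two factors is
  positive, so one of the summands is homothetic to the sum.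
\<close>

text \<open>Cancellation: a point \<open>x\<close> of \<open>Q - a\<close> satisfies \<open>x + (1 - l) P \<subseteq> P\<close>, so
  \<open>p \<mapsto> x + (1 - l) p\<close> is a contraction of \<open>P\<close>. Its fixed point \<open>p\<close> lies in \<open>P\<close> and satisfies
  \<open>x = l p\<close>.\<close>

lemma homothetic_summand:
  fixes P Q R :: "'a::banach set"
  assumes P: "complete P" "P \<noteq> {}" and sum: "P = Q + R"
    and l: "0 < l" "l \<le> 1"
    and Q: "\<And>p. p \<in> P \<Longrightarrow> l *\<^sub>R p + a \<in> Q"
    and R: "\<And>p. p \<in> P \<Longrightarrow> (1 - l) *\<^sub>R p - a \<in> R"
  shows "homothetic P Q"
proof -
  have "q \<in> (\<lambda>p. l *\<^sub>R p + a) ` P" if q: "q \<in> Q" for q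
  proof -
    let ?f = "\<lambda>p. (q - a) + (1 - l) *\<^sub>R p"
    have "?f p \<in> P" if "p \<in> P" for p
      using set_plus_intro[OF q R[OF that]] unfolding sum[symmetric] by (simp add: algebra_simps)
    moreover have "dist (?f x) (?f y) \<le> (1 - l) * dist x y" for x y
    proof -
      have "?f x - ?f y = (1 - l) *\<^sub>R (x - y)"
        by (simp add: algebra_simps)
      then show ?thesis
        using l by (simp add: dist_norm)
    qed
    ultimately have "\<exists>!p\<in>P. ?f p = p"
      using P l by (intro Banach_fix[where c = "1 - l"]) auto
    then obtain p where "p \<in> P" "?f p = p"
      by blast
    moreover from this have "q = l *\<^sub>R p + a"
      by (simp add: algebra_simps)
    ultimately show ?thesis
      by blast
  qed
  then have "Q = (\<lambda>p. l *\<^sub>R p + a) ` P"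
    using Q by blast
  then show ?thesis
    unfolding homothetic_def using l by blast
qed

definition permutation_matrix :: "('n \<Rightarrow> 'n) \<Rightarrow> real^'n^'n" where
  "permutation_matrix p = (\<chi> i j. if p i = j then 1 else 0)"

lemma permutation_matrices_eq_image:
  "permutation_matrices = permutation_matrix ` {p. p permutes (UNIV :: 'n::finite set)}"
  unfolding permutation_matrices_def permutation_matrix_def by blast

lemma finite_permutation_matrices: "finite (permutation_matrices :: (real^'n::finite^'n) set)"
  unfolding permutation_matrices_eq_image by (intro finite_imageI finite_permutations) simp

lemma permutation_matrix_in_Birkhoff:
  "p permutes UNIV \<Longrightarrow> permutation_matrix p \<in> (Birkhoff :: (real^'n::finite^'n) set)"
  unfolding Birkhoff_def permutation_matrices_eq_image by (intro hull_inc) blast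

lemma polytope_Birkhoff: "polytope (Birkhoff :: (real^'n::finite^'n) set)"
  unfolding Birkhoff_def polytope_def using finite_permutation_matrices by blast

lemma Birkhoff_doubly_stochastic:
  fixes x :: "real^'n::finite^'n"
  assumes "x \<in> Birkhoff"
  shows "0 \<le> x $ i $ j" "(\<Sum>j\<in>UNIV. x $ i $ j) = 1" "(\<Sum>i\<in>UNIV. x $ i $ j) = 1"
proof -
  let ?D = "{x :: real^'n^'n. (\<forall>i j. 0 \<le> x $ i $ j) \<and> (\<forall>i. (\<Sum>j\<in>UNIV. x $ i $ j) = 1)
                               \<and> (\<forall>j. (\<Sum>i\<in>UNIV. x $ i $ j) = 1)}"
  have "(\<Sum>i\<in>UNIV. permutation_matrix p $ i $ j) = 1" if "p permutes UNIV" for p :: "'n \<Rightarrow> 'n" and j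
  proof -
    have "p i = j \<longleftrightarrow> inv p j = i" for i
      using permutes_inverses[OF that] by auto
    then show ?thesis
      by (simp add: permutation_matrix_def)
  qed
  then have "permutation_matrices \<subseteq> ?D"
    by (auto simp: permutation_matrices_eq_image) (auto simp: permutation_matrix_def)
  moreover have "convex ?D"
    by (rule convexI) (auto simp: sum.distrib sum_distrib_left[symmetric])
  ultimately have "Birkhoff \<subseteq> ?D"
    unfolding Birkhoff_def by (rule hull_minimal)
  then show "0 \<le> x $ i $ j" "(\<Sum>j\<in>UNIV. x $ i $ j) = 1" "(\<Sum>i\<in>UNIV. x $ i $ j) = 1"
    using assms by auto
qed

text \<open>The entrywise minimum of \<open>Q\<close> is the translation that makes both summands nonnegative: a
  negative entry in \<open>R + a\<close> would, added to a point of \<open>Q\<close> attaining the minimum in that entry,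
  give a negative entry in \<open>Q + R\<close>.\<close>

lemma nonnegative_translates:
  fixes Q R :: "(real^'n::finite^'m::finite) set"
  assumes "compact Q" "Q \<noteq> {}"
    and nonneg: "\<And>x i j. x \<in> Q + R \<Longrightarrow> 0 \<le> x $ i $ j"
  obtains a where "\<And>q i j. q \<in> Q \<Longrightarrow> 0 \<le> (q - a) $ i $ j" "\<And>r i j. r \<in> R \<Longrightarrow> 0 \<le> (r + a) $ i $ j"
proof -
  have "\<exists>m\<in>Q. \<forall>q\<in>Q. m $ i $ j \<le> q $ i $ j" for i j
    using assms by (intro continuous_attains_inf continuous_intros) auto
  then obtain m where m: "\<And>i j. m i j \<in> Q" "\<And>i j q. q \<in> Q \<Longrightarrow> m i j $ i $ j \<le> q $ i $ j"
    by metis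
  show thesis
  proof (rule that[of "\<chi> i j. m i j $ i $ j"])
    show "0 \<le> (r + (\<chi> i j. m i j $ i $ j)) $ i $ j" if "r \<in> R" for r i j
      using nonneg[OF set_plus_intro[OF m(1)[of i j] that], of i j] by (simp add: add.commute)
  qed (simp add: m)
qed

text \<open>Each permutation matrix is a sum of a point of \<open>Q - a\<close> and a point of \<open>R + a\<close>, and bounds
  the supports of both because they are nonnegative. Together with the constancy of the row and
  column sums this leaves only one degree of freedom, the factor \<open>l\<close>. It suffices to treat the
  permutation matrices, as the summands are convex.\<close>

lemma Birkhoff_summands_contain_scaled_copies:
  fixes Q R :: "(real^'n::finite^'n) set"
  assumes "compact Q" "convex Q" "convex R" and sum: "Birkhoff = Q + R"
  obtains l a where "0 \<le> l" "l \<le> 1"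
    "\<And>p. p \<in> Birkhoff \<Longrightarrow> l *\<^sub>R p + a \<in> Q" "\<And>p. p \<in> Birkhoff \<Longrightarrow> (1 - l) *\<^sub>R p - a \<in> R"
proof -
  have "permutation_matrix id \<in> Q + R"
    unfolding sum[symmetric] by (intro permutation_matrix_in_Birkhoff permutes_id)
  then obtain q0 r0 where q0: "q0 \<in> Q" and r0: "r0 \<in> R"
    by (auto elim: set_plus_elim)
  have D: "0 \<le> x $ i $ j" "(\<Sum>j\<in>UNIV. x $ i $ j) = 1" "(\<Sum>i\<in>UNIV. x $ i $ j) = 1"
    if "x \<in> Q + R" for x i j
    using that unfolding sum[symmetric] by (rule Birkhoff_doubly_stochastic)+
  obtain a where a: "\<And>q i j. q \<in> Q \<Longrightarrow> 0 \<le> (q - a) $ i $ j" "\<And>r i j. r \<in> R \<Longrightarrow> 0 \<le> (r + a) $ i $ j"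
    using nonnegative_translates[of Q R] assms q0 D(1) by blast
  \<comment> \<open>A row or column sum over \<open>q - a\<close> is complementary to the one over \<open>r0 + a\<close>, for one \<open>r0\<close> that
    serves all \<open>q\<close>; hence it does not depend on \<open>q\<close>.\<close>
  define \<rho> where "\<rho> i = 1 - (\<Sum>j\<in>UNIV. (r0 + a) $ i $ j)" for i
  define \<kappa> where "\<kappa> j = 1 - (\<Sum>i\<in>UNIV. (r0 + a) $ i $ j)" for j
  have row: "(\<Sum>j\<in>UNIV. (q - a) $ i $ j) = \<rho> i" if "q \<in> Q" for q i
    using D(2)[OF set_plus_intro[OF that r0], of i]
    by (simp add: \<rho>_def sum.distrib sum_subtractf)
  have col: "(\<Sum>i\<in>UNIV. (q - a) $ i $ j) = \<kappa> j" if "q \<in> Q" for q j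
    using D(3)[OF set_plus_intro[OF that r0], of j]
    by (simp add: \<kappa>_def sum.distrib sum_subtractf)
  have split: "\<exists>q r. q \<in> Q \<and> r \<in> R \<and> permutation_matrix p = q + r \<and> \<kappa> (p i) = \<rho> i
      \<and> (\<forall>i j. (q - a) $ i $ j = (if p i = j then \<rho> i else 0))"
    if p: "p permutes UNIV" for p i
  proof -
    obtain q r where qr: "q \<in> Q" "r \<in> R" "permutation_matrix p = q + r"
      using permutation_matrix_in_Birkhoff[OF p] unfolding sum by (auto elim: set_plus_elim)
    have zero: "(q - a) $ i $ j = 0" if "p i \<noteq> j" for i j
    proof -
      have "(q - a) $ i $ j + (r + a) $ i $ j = permutation_matrix p $ i $ j"
        by (simp add: qr(3))
      then show ?thesis
        using that a(1)[OF qr(1), of i j] a(2)[OF qr(2), of i j]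
        by (simp add: permutation_matrix_def)
    qed
    have entry_row: "(q - a) $ i $ p i = \<rho> i" for i
    proof -
      have "(\<Sum>j\<in>UNIV. (q - a) $ i $ j) = (\<Sum>j\<in>{p i}. (q - a) $ i $ j)"
        using zero by (intro sum.mono_neutral_right) auto
      then show ?thesis
        using row[OF qr(1)] by simp
    qed
    have entry_col: "(q - a) $ i $ p i = \<kappa> (p i)"
    proof -
      have "(\<Sum>k\<in>UNIV. (q - a) $ k $ p i) = (\<Sum>k\<in>{i}. (q - a) $ k $ p i)"
        using zero permutes_inj[OF p] by (intro sum.mono_neutral_right) (auto dest: injD)
      then show ?thesis
        using col[OF qr(1)] by simp
    qed
    show ?thesis
      using qr zero entry_row entry_col by (intro exI[of _ q] exI[of _ r]) auto
  qed
  have "\<kappa> j = \<rho> i" for i j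
    using split[OF permutes_swap_id[of i UNIV j], of i] by auto
  then obtain l where l: "\<And>i. \<rho> i = l"
    by metis
  have vertex: "l *\<^sub>R permutation_matrix p + a \<in> Q" "(1 - l) *\<^sub>R permutation_matrix p - a \<in> R"
    if p: "p permutes UNIV" for p
  proof -
    obtain q r where qr: "q \<in> Q" "r \<in> R" "permutation_matrix p = q + r"
      and entry: "\<And>i j. (q - a) $ i $ j = (if p i = j then l else 0)"
      using split[OF p] l by metis
    have "q - a = l *\<^sub>R permutation_matrix p"
      by (simp only: vec_eq_iff entry) (simp add: permutation_matrix_def)
    then have "l *\<^sub>R permutation_matrix p + a = q" "(1 - l) *\<^sub>R permutation_matrix p - a = r"
      using qr(3) by (simp_all add: algebra_simps)
    then show "l *\<^sub>R permutation_matrix p + a \<in> Q" "(1 - l) *\<^sub>R permutation_matrix p - a \<in> R"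
      using qr by simp_all
  qed
  \<comment> \<open>Any diagonal entry of the two parts of the identity matrix will do.\<close>
  have "0 \<le> l" "l \<le> 1"
    using a(1)[OF vertex(1)[OF permutes_id], of undefined undefined]
      a(2)[OF vertex(2)[OF permutes_id], of undefined undefined]
    by (simp_all add: permutation_matrix_def)
  moreover have hull: "c *\<^sub>R x + b \<in> S"
    if "convex S" "\<And>p. p permutes UNIV \<Longrightarrow> c *\<^sub>R permutation_matrix p + b \<in> S" "x \<in> Birkhoff"
    for c b x and S :: "(real^'n^'n) set"
  proof -
    have "(\<lambda>x. c *\<^sub>R x + b) ` Birkhoff
        = convex hull ((\<lambda>x. c *\<^sub>R x + b) ` permutation_matrices)"
      unfolding Birkhoff_def by (simp add: convex_hull_affinity[symmetric] add.commute)
    also have "\<dots> \<subseteq> S"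
      using that(1,2) by (intro hull_minimal) (auto simp: permutation_matrices_eq_image)
    finally show ?thesis
      using that(3) by blast
  qed
  ultimately show thesis
    using that[of l a] hull[OF \<open>convex Q\<close>, of l a] hull[OF \<open>convex R\<close>, of "1 - l" "- a"] vertex
    by simp
qed

theorem corollary4p5:
  shows "indecomposable (Birkhoff :: (real^'n::finite^'n) set)"
proof -
  let ?P = "Birkhoff :: (real^'n^'n) set"
  have "homothetic ?P Q \<or> homothetic ?P R"
    if QR: "polytope Q" "polytope R" and sum: "?P = Q + R" for Q R
  proof -
    have P: "complete ?P" "?P \<noteq> {}"
      using polytope_Birkhoff permutation_matrix_in_Birkhoff[OF permutes_id]
      by (auto intro: compact_imp_complete polytope_imp_compact)
    obtain l a where l: "0 \<le> l" "l \<le> 1"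
      and Q: "\<And>p. p \<in> ?P \<Longrightarrow> l *\<^sub>R p + a \<in> Q" and R: "\<And>p. p \<in> ?P \<Longrightarrow> (1 - l) *\<^sub>R p - a \<in> R"
      by (rule Birkhoff_summands_contain_scaled_copies[OF polytope_imp_compact[OF QR(1)]
            polytope_imp_convex[OF QR(1)] polytope_imp_convex[OF QR(2)] sum]) blast
    show ?thesis
    proof (cases "l = 0")
      case False
      then show ?thesis
        using homothetic_summand[OF P sum _ l(2) Q R] l(1) by simp
    next
      case True
      \<comment> \<open>The summands exchange roles, with factor \<open>1\<close> and translation \<open>- a\<close>.\<close>
      then show ?thesis
        using homothetic_summand[of ?P R Q 1 "- a"] P sum Q R by (simp add: add.commute)
    qed
  qed
  then show ?thesis
    using polytope_Birkhoff unfolding indecomposable_def decomposable_def by blast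
qed

end
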